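(* Let $r>0$, $x_0\in\mathbb{R}$, and let $f_1,f_2:\mathbb{R}\to\mathbb{R}$ be convex and differentiable on the whole of $\mathbb{R}$ such that $$f(x)=\begin{cases}f_1(x),&\text{if }x\le x_0,\\ f_2(x),&\text{if }x\ge x_0\end{cases}$$ is (well defined and) convex. Then $$P_rf(x)=\begin{cases}P_rf_1(x),&\text{if }x<x_0+\frac1rf_1'(x_0),\\ x_0,&\text{if }x_0+\frac1rf_1'(x_0)\le x\le x_0+\frac1rf_2'(x_0),\\ P_rf_2(x),&\text{if }x>x_0+\frac1rf_2'(x_0),\end{cases}$$ $$e_rf(x)=\begin{cases}e_rf_1(x),&\text{if }x<x_0+\frac1rf_1'(x_0),\\ f_1(x_0)+\frac r2(x_0-x)^2,&\text{if }x_0+\frac1rf_1'(x_0)\le x\le x_0+\frac1rf_2'(x_0),\\ e_rf_2(x),&\text{if }x>x_0+\frac1rf_2'(x_0).\end{cases}$$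
   Context: For a function $f:\mathbb{R}\to\mathbb{R}\cup\{\infty\}$ and $r>0$, the Moreau envelope is $e_rf(x)=\inf_{y\in\mathbb{R}}\{f(y)+\frac r2(y-x)^2\}$ and the proximal mapping is $P_rf(x)=\operatorname{argmin}_{y\in\mathbb{R}}\{f(y)+\frac r2(y-x)^2\}$ (a singleton when $f$ is proper, lower semicontinuous and convex, in which case it is identified with its unique element). *)

theory Defs
  imports "HOL-Analysis.Analysis"
begin

text \<open>
  Functions with values in the reals extended by \<open>\<infinity>\<close> are rendered as functions into
  \<^typ>\<open>ereal\<close>; a finite function is embedded by composing it with \<^const>\<open>ereal\<close>.
  The infimum in the envelope is the complete-lattice one of \<^typ>\<open>ereal\<close>, so it may
  also be \<open>- \<infinity>\<close>.
\<close>

definition moreau_envelope :: "real \<Rightarrow> (real \<Rightarrow> ereal) \<Rightarrow> real \<Rightarrow> ereal" where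
  "moreau_envelope r f x = (INF y. f y + ereal (r / 2 * (y - x)\<^sup>2))"

text \<open>
  The proximal mapping is the set of all minimizers. For proper, lower semicontinuous
  convex \<open>f\<close>, where one writes \<open>P\<^sub>r f(x) = p\<close>, the formal counterpart is
  \<open>prox r f x = {p}\<close>.
\<close>

definition prox :: "real \<Rightarrow> (real \<Rightarrow> ereal) \<Rightarrow> real \<Rightarrow> real set" where
  "prox r f x = {y. is_arg_min (\<lambda>z. f z + ereal (r / 2 * (z - x)\<^sup>2)) (\<lambda>_. True) y}"

end

theory Submission
  imports Defs
begin

text \<open>
  Below the middle interval, the proximal objective of \<open>f1\<close> at \<open>x\<close> has positive slope at \<open>x0\<close>, so
  some point \<open>a < x0\<close> has a smaller value than \<open>x0\<close>. By convexity the objectives of \<open>f\<close> and \<open>f1\<close>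
  both exceed their common value at \<open>x0\<close> to the right of \<open>x0\<close>, hence only the half-line where they
  coincide matters; above the interval the situation is mirrored. On the middle interval, the
  tangents of \<open>f1\<close> and \<open>f2\<close> at \<open>x0\<close> show that \<open>x0\<close> is the strict minimizer.
\<close>

text \<open>Every point outside \<open>S\<close> is strictly beaten by one inside, for
  \<open>f\<close> and for \<open>g\<close>, so neither the minimizers nor the infimum depend on
  values off \<open>S\<close>.\<close>

lemma prox_moreau_envelope_cong_on:
  fixes f g :: "real \<Rightarrow> ereal" and r x :: real
  defines "\<phi> \<equiv> \<lambda>h y. h y + ereal (r / 2 * (y - x)\<^sup>2)"
  assumes eq: "\<And>y. y \<in> S \<Longrightarrow> f y = g y"
    and f: "\<And>z. z \<notin> S \<Longrightarrow> \<exists>y\<in>S. \<phi> f y < \<phi> f z"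
    and g: "\<And>z. z \<notin> S \<Longrightarrow> \<exists>y\<in>S. \<phi> g y < \<phi> g z"
  shows "prox r f x = prox r g x" and "moreau_envelope r f x = moreau_envelope r g x"
proof -
  have phi_eq: "\<phi> f y = \<phi> g y" if "y \<in> S" for y
    using eq[OF that] by (simp add: \<phi>_def)
  \<comment> \<open>Strictness keeps minimizers inside \<open>S\<close>; conversely, a minimizer
    over \<open>S\<close> is also below each outside \<open>z\<close>, by way of the point of
    \<open>S\<close> that beats \<open>z\<close>.\<close>
  have argmin_iff: "(\<forall>z. \<phi> h y \<le> \<phi> h z) \<longleftrightarrow> y \<in> S \<and> (\<forall>z\<in>S. \<phi> h y \<le> \<phi> h z)"
    if "\<And>z. z \<notin> S \<Longrightarrow> \<exists>y\<in>S. \<phi> h y < \<phi> h z" for h y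
    by (meson leD less_imp_le order_trans that)
  have prox: "prox r h x = {y. \<forall>z. \<phi> h y \<le> \<phi> h z}" for h
    by (auto simp: prox_def is_arg_min_linorder \<phi>_def)
  show "prox r f x = prox r g x"
    unfolding prox using argmin_iff[of f, OF f] argmin_iff[of g, OF g] phi_eq by auto
  have INF_S: "moreau_envelope r h x = (INF y\<in>S. \<phi> h y)"
    if "\<And>z. z \<notin> S \<Longrightarrow> \<exists>y\<in>S. \<phi> h y < \<phi> h z" for h
  proof (rule antisym)
    have INF: "moreau_envelope r h x = (INF y. \<phi> h y)"
      by (simp add: moreau_envelope_def \<phi>_def)
    show "moreau_envelope r h x \<le> (INF y\<in>S. \<phi> h y)"
      unfolding INF
      by (rule INF_superset_mono) auto
    show "(INF y\<in>S. \<phi> h y) \<le> moreau_envelope r h x"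
      unfolding INF
      \<comment> \<open>Each point is matched with itself if it lies in \<open>S\<close>, otherwise
        with the point of \<open>S\<close> that beats it.\<close>
      by (rule INF_mono) (meson less_imp_le order_refl that)
  qed
  show "moreau_envelope r f x = moreau_envelope r g x"
    using INF_S[of f, OF f] INF_S[of g, OF g] INF_cong[OF refl phi_eq, of S] by simp
qed

lemma prox_moreau_envelope_strict_min:
  fixes f :: "real \<Rightarrow> real"
  assumes "\<And>y. y \<noteq> p \<Longrightarrow> f p + r / 2 * (p - x)\<^sup>2 < f y + r / 2 * (y - x)\<^sup>2"
  shows "prox r (\<lambda>y. ereal (f y)) x = {p}"
    and "moreau_envelope r (\<lambda>y. ereal (f y)) x = ereal (f p + r / 2 * (p - x)\<^sup>2)"
proof -
  have le: "f p + r / 2 * (p - x)\<^sup>2 \<le> f y + r / 2 * (y - x)\<^sup>2" for y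
    using assms[of y] by (cases "y = p") auto
  show "prox r (\<lambda>y. ereal (f y)) x = {p}"
    using le assms unfolding prox_def is_arg_min_linorder by (auto simp: not_le[symmetric])
  show "moreau_envelope r (\<lambda>y. ereal (f y)) x = ereal (f p + r / 2 * (p - x)\<^sup>2)"
    unfolding moreau_envelope_def using le by (intro antisym INF_lower2[of p] INF_greatest) auto
qed

text \<open>A convex function that has risen from \<open>a\<close> to \<open>b\<close> stays above
  its value at \<open>b\<close> further along the same ray. Using \<open>closed_segment\<close>
  instead of an order covers both directions at once.\<close>

lemma convex_on_UNIV_less_beyond:
  fixes \<phi> :: "real \<Rightarrow> real"
  assumes "convex_on UNIV \<phi>" and "\<phi> a < \<phi> b" and "b \<in> closed_segment a z" and "z \<noteq> b"
  shows "\<phi> b < \<phi> z"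
proof -
  obtain t where t: "0 \<le> t" "t \<le> 1" and b: "b = (1 - t) *\<^sub>R a + t *\<^sub>R z"
    using assms(3) by (auto simp: closed_segment_def)
  have "t \<noteq> 1" using b assms(4) by auto
  have "\<phi> b \<le> (1 - t) * \<phi> a + t * \<phi> z"
    unfolding b using convex_onD[OF assms(1), of t a z] t by simp
  \<comment> \<open>Since \<open>z\<close> differs from \<open>b\<close>, the weight
    \<open>1 - t\<close> is positive, so replacing \<open>\<phi> a\<close> by
    \<open>\<phi> b\<close> is a strict increase. The resulting strict inequality also excludes
    \<open>t = 0\<close>.\<close>
  also have "\<dots> < (1 - t) * \<phi> b + t * \<phi> z"
    using assms(2) t \<open>t \<noteq> 1\<close> by simp
  finally have "t * \<phi> b < t * \<phi> z" by (simp add: algebra_simps)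
  thus ?thesis using t by (simp add: mult_less_cancel_left)
qed

lemma convex_on_proximal_objective:
  fixes h :: "real \<Rightarrow> real"
  assumes "r \<ge> 0" and "convex_on UNIV h"
  shows "convex_on UNIV (\<lambda>y. h y + r / 2 * (y - x)\<^sup>2)"
proof -
  have "convex_on UNIV (\<lambda>y. r / 2 * (y - x)\<^sup>2)"
    by (rule f''_ge0_imp_convex[where f' = "\<lambda>y. r * (y - x)" and f'' = "\<lambda>_. r"])
      (use assms in \<open>auto intro!: derivative_eq_intros\<close>)
  with assms(2) show ?thesis by (rule convex_on_add)
qed

text \<open>Think of \<open>S\<close> as a half-line with endpoint \<open>p\<close>: leaving
  \<open>S\<close> from \<open>a\<close> means passing \<open>p\<close>, where the objective is
  already larger than at \<open>a\<close>. Hence \<open>p\<close> beats every point outside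
  \<open>S\<close>.\<close>

lemma prox_moreau_envelope_one_sided:
  fixes f g :: "real \<Rightarrow> real"
  assumes "r \<ge> 0" and "convex_on UNIV f" and "convex_on UNIV g"
    and eq: "\<And>y. y \<in> S \<Longrightarrow> f y = g y"
    and "a \<in> S" and "p \<in> S" and seg: "\<And>z. z \<notin> S \<Longrightarrow> p \<in> closed_segment a z"
    and less: "g a + r / 2 * (a - x)\<^sup>2 < g p + r / 2 * (p - x)\<^sup>2"
  shows "prox r (\<lambda>y. ereal (f y)) x = prox r (\<lambda>y. ereal (g y)) x"
    and "moreau_envelope r (\<lambda>y. ereal (f y)) x = moreau_envelope r (\<lambda>y. ereal (g y)) x"
proof -
  \<comment> \<open>Stated for a generic \<open>h\<close> because it is used with both
    \<open>f\<close> and \<open>g\<close>, whose objectives agree at \<open>a\<close> and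
    \<open>p\<close>.\<close>
  have *: "\<exists>y\<in>S. ereal (h y) + ereal (r / 2 * (y - x)\<^sup>2) < ereal (h z) + ereal (r / 2 * (z - x)\<^sup>2)"
    if h: "convex_on UNIV h" and hg: "\<And>y. y \<in> S \<Longrightarrow> h y = g y" and z: "z \<notin> S" for h z
  proof -
    have "h p + r / 2 * (p - x)\<^sup>2 < h z + r / 2 * (z - x)\<^sup>2"
      using convex_on_UNIV_less_beyond[OF convex_on_proximal_objective[OF assms(1) h], where z = z]
        less seg[OF z] hg \<open>a \<in> S\<close> \<open>p \<in> S\<close> z by metis
    thus ?thesis using \<open>p \<in> S\<close> by auto
  qed
  show "prox r (\<lambda>y. ereal (f y)) x = prox r (\<lambda>y. ereal (g y)) x"
    and "moreau_envelope r (\<lambda>y. ereal (f y)) x = moreau_envelope r (\<lambda>y. ereal (g y)) x"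
    using prox_moreau_envelope_cong_on[of S "\<lambda>y. ereal (f y)" "\<lambda>y. ereal (g y)" r x]
      *[OF assms(2)] *[OF assms(3)] eq by auto
qed

text \<open>The factor \<open>D + r * (p - x)\<close> is the slope of the objective at
  \<open>p\<close>; it only has to be nonnegative in the direction of \<open>y\<close>. The square
  \<open>r / 2 * (y - p)\<^sup>2\<close> left over from expanding the quadratic at \<open>p\<close>
  makes the inequality strict.\<close>

lemma proximal_objective_above_tangent:
  fixes h :: "real \<Rightarrow> real"
  assumes "r > 0" and "convex_on UNIV h" and "(h has_real_derivative D) (at p)"
    and "y \<noteq> p" and "(D + r * (p - x)) * (y - p) \<ge> 0"
  shows "h p + r / 2 * (p - x)\<^sup>2 < h y + r / 2 * (y - x)\<^sup>2"
proof -
  have "h y - h p \<ge> D * (y - p)"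
    using assms by (intro convex_on_imp_above_tangent[where A = UNIV]) auto
  moreover have "r / 2 * (y - x)\<^sup>2 - r / 2 * (p - x)\<^sup>2 = r * (p - x) * (y - p) + r / 2 * (y - p)\<^sup>2"
    by (simp add: power2_eq_square field_simps)
  moreover have "r / 2 * (y - p)\<^sup>2 > 0" using assms by simp
  moreover have "D * (y - p) + r * (p - x) * (y - p) \<ge> 0"
    using assms(5) by (simp add: algebra_simps)
  ultimately show ?thesis by linarith
qed

theorem proposition3p13:
  fixes r x0 :: real and f1 f2 f :: "real \<Rightarrow> real"
  assumes "r > 0"
    and "convex_on UNIV f1" and "f1 differentiable_on UNIV"
    and "convex_on UNIV f2" and "f2 differentiable_on UNIV"
    and "\<And>x. x \<le> x0 \<Longrightarrow> f x = f1 x"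
    and "\<And>x. x \<ge> x0 \<Longrightarrow> f x = f2 x"
    and "convex_on UNIV f"
  shows "(\<forall>x.
      (x < x0 + 1 / r * deriv f1 x0 \<longrightarrow>
        prox r (\<lambda>y. ereal (f y)) x = prox r (\<lambda>y. ereal (f1 y)) x) \<and>
      (x0 + 1 / r * deriv f1 x0 \<le> x \<and> x \<le> x0 + 1 / r * deriv f2 x0 \<longrightarrow>
        prox r (\<lambda>y. ereal (f y)) x = {x0}) \<and>
      (x > x0 + 1 / r * deriv f2 x0 \<longrightarrow>
        prox r (\<lambda>y. ereal (f y)) x = prox r (\<lambda>y. ereal (f2 y)) x)) \<and>
    (\<forall>x.
      (x < x0 + 1 / r * deriv f1 x0 \<longrightarrow>
        moreau_envelope r (\<lambda>y. ereal (f y)) x = moreau_envelope r (\<lambda>y. ereal (f1 y)) x) \<and>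
      (x0 + 1 / r * deriv f1 x0 \<le> x \<and> x \<le> x0 + 1 / r * deriv f2 x0 \<longrightarrow>
        moreau_envelope r (\<lambda>y. ereal (f y)) x = ereal (f1 x0 + r / 2 * (x0 - x)\<^sup>2)) \<and>
      (x > x0 + 1 / r * deriv f2 x0 \<longrightarrow>
        moreau_envelope r (\<lambda>y. ereal (f y)) x = moreau_envelope r (\<lambda>y. ereal (f2 y)) x))"
proof -
  have der1: "(f1 has_real_derivative deriv f1 x0) (at x0)"
    and der2: "(f2 has_real_derivative deriv f2 x0) (at x0)"
    using assms(3,5) by (auto simp: differentiable_on_def DERIV_deriv_iff_real_differentiable)
  have obj_der: "((\<lambda>y. h y + r / 2 * (y - x)\<^sup>2) has_real_derivative D + r * (x0 - x)) (at x0)"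
    if "(h has_real_derivative D) (at x0)" for h D x
    using that by (auto intro!: derivative_eq_intros)
  have below: "prox r (\<lambda>y. ereal (f y)) x = prox r (\<lambda>y. ereal (f1 y)) x \<and>
      moreau_envelope r (\<lambda>y. ereal (f y)) x = moreau_envelope r (\<lambda>y. ereal (f1 y)) x"
    if x: "x < x0 + 1 / r * deriv f1 x0" for x
  proof -
    \<comment> \<open>Multiplied by \<open>r\<close>, the bound on \<open>x\<close> is exactly the
      sign of the slope of the objective at \<open>x0\<close>.\<close>
    have "0 < deriv f1 x0 + r * (x0 - x)" using x \<open>r > 0\<close> by (simp add: field_simps)
    from DERIV_pos_inc_left[OF obj_der[OF der1] this] obtain d where "d > 0"
      and d: "\<And>h. 0 < h \<Longrightarrow> h < d \<Longrightarrow>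
        f1 (x0 - h) + r / 2 * (x0 - h - x)\<^sup>2 < f1 x0 + r / 2 * (x0 - x)\<^sup>2" by auto
    show ?thesis
      \<comment> \<open>Any point of the open interval from \<open>x0 - d\<close> to
        \<open>x0\<close> would do as \<open>a\<close>; the midpoint is taken.\<close>
      using prox_moreau_envelope_one_sided[of r f f1 "{..x0}" "x0 - d / 2" x0 x]
        d[of "d / 2"] \<open>d > 0\<close> assms by (auto simp: closed_segment_eq_real_ivl)
  qed
  have above: "prox r (\<lambda>y. ereal (f y)) x = prox r (\<lambda>y. ereal (f2 y)) x \<and>
      moreau_envelope r (\<lambda>y. ereal (f y)) x = moreau_envelope r (\<lambda>y. ereal (f2 y)) x"
    if x: "x > x0 + 1 / r * deriv f2 x0" for x
  proof -
    have "deriv f2 x0 + r * (x0 - x) < 0" using x \<open>r > 0\<close> by (simp add: field_simps)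
    from DERIV_neg_dec_right[OF obj_der[OF der2] this] obtain d where "d > 0"
      and d: "\<And>h. 0 < h \<Longrightarrow> h < d \<Longrightarrow>
        f2 (x0 + h) + r / 2 * (x0 + h - x)\<^sup>2 < f2 x0 + r / 2 * (x0 - x)\<^sup>2" by auto
    show ?thesis
      using prox_moreau_envelope_one_sided[of r f f2 "{x0..}" "x0 + d / 2" x0 x]
        d[of "d / 2"] \<open>d > 0\<close> assms by (auto simp: closed_segment_eq_real_ivl)
  qed
  have middle: "f x0 + r / 2 * (x0 - x)\<^sup>2 < f y + r / 2 * (y - x)\<^sup>2"
    if x: "x0 + 1 / r * deriv f1 x0 \<le> x" "x \<le> x0 + 1 / r * deriv f2 x0" and "y \<noteq> x0" for x y
  \<comment> \<open>Each side uses the tangent of its own piece: the slope of that objective at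
    \<open>x0\<close> and \<open>y - x0\<close> have compatible signs, so their product is
    nonnegative.\<close>
  proof (cases "y \<le> x0")
    case True
    have "deriv f1 x0 + r * (x0 - x) \<le> 0" using x(1) \<open>r > 0\<close> by (simp add: field_simps)
    with True have "(deriv f1 x0 + r * (x0 - x)) * (y - x0) \<ge> 0"
      by (intro mult_nonpos_nonpos) auto
    from proximal_objective_above_tangent[OF \<open>r > 0\<close> assms(2) der1 \<open>y \<noteq> x0\<close> this]
    show ?thesis using True assms(6) by simp
  next
    case False
    have "deriv f2 x0 + r * (x0 - x) \<ge> 0" using x(2) \<open>r > 0\<close> by (simp add: field_simps)
    with False have "(deriv f2 x0 + r * (x0 - x)) * (y - x0) \<ge> 0"
      by (intro mult_nonneg_nonneg) auto
    from proximal_objective_above_tangent[OF \<open>r > 0\<close> assms(4) der2 \<open>y \<noteq> x0\<close> this]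
    show ?thesis using False assms(7) by simp
  qed
  have "f x0 = f1 x0" using assms(6) by simp
  with below above prox_moreau_envelope_strict_min[of x0 f r, OF middle] show ?thesis
    by simp
qed

end
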